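(* Let $\tfrac12\le\beta<1$ and let $a>0$ be a real number. (i) (Case $t=1$.) For every fixed constant $r>0$, the function $$(x,p)\mapsto x^{a}\,(r\,p)^{1-\beta},\qquad x\in[0,1],\ p\in(0,1],$$ is jointly concave if and only if $a\le\beta$. (ii) (Case $t>1$.) The function $$(x,p,r)\mapsto x^{a}\,(r\,p)^{1-\beta},\qquad x\in[0,1],\ p\in(0,1],\ r\in(0,\infty),$$ is jointly concave if and only if $a\le 2\beta-1$.
   Context: In the application, the function is the term $h(x^t_{\mu,\alpha})\,(r^t_{\mu,\alpha}p^t_{\mu,\alpha})^{1-\beta}$, with $h(x)=x^a$, $a>0$, of a relaxed resource allocation objective for user $\mu$, access point $\alpha$ and service time $t$. Here $x$ is a relaxed assignment variable, $p$ a proportion of resources, and $r$ a data rate. For $t=1$ the rate is a given constant, while for $t>1$ the rate is treated as an independent optimization variable. *)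

theory Defs
  imports "HOL-Analysis.Analysis"
begin

end

theory Submission
  imports Defs
begin

text \<open>
  A monomial with nonnegative exponents of sum at most 1 lies below its tangent plane at every
  positive point: after dividing by the value at that point, this is the weighted AM-GM inequality
  with the constant 1 as an extra term of weight 1 minus the sum of the exponents. Conversely,
  concavity at the midpoint of (0, e, e) and (1, 1, 1) forces, as e tends to 0, that the exponents
  sum to at most 1. The sum is a + 1 - \<beta> in case (i) and a + 2 (1 - \<beta>) in case (ii).
\<close>

text \<open>The right-hand side \<open>m\<close> is the weighted mean of \<open>u\<close>,
  \<open>v\<close>, \<open>w\<close> and 1. The logarithm lies below its tangent at
  \<open>m\<close>; averaging that bound over the four values cancels the linear terms exactly
  because \<open>m\<close> is their mean.\<close>

lemma weighted_am_gm3: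
  fixes a b c u v w :: real
  assumes "a \<ge> 0" "b \<ge> 0" "c \<ge> 0" "a + b + c \<le> 1" and "u > 0" "v > 0" "w > 0"
  shows "u powr a * v powr b * w powr c \<le> 1 + a * (u - 1) + b * (v - 1) + c * (w - 1)"
proof -
  define m where "m = 1 + a * (u - 1) + b * (v - 1) + c * (w - 1)"
  have ln_le: "ln x \<le> ln m + (x / m - 1)" if "x > 0" "m > 0" for x
    using ln_le_minus_one[of "x / m"] that by (simp add: ln_div)
  have m: "m = a * u + b * v + c * w + (1 - a - b - c)"
    unfolding m_def by (simp add: algebra_simps)
  \<comment> \<open>The weight of the constant 1 is \<open>1 - a - b - c\<close>. If it vanishes,
    one of the other weights must be positive.\<close>
  have "m > 0"
  proof (cases "a + b + c = 1")
    case True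
    then have "a > 0 \<or> b > 0 \<or> c > 0" using assms by linarith
    then have "a * u > 0 \<or> b * v > 0 \<or> c * w > 0" using assms by auto
    then show ?thesis
      unfolding m using True assms
      by (smt (verit) mult_nonneg_nonneg)
  next
    case False
    then show ?thesis
      unfolding m using assms by (smt (verit) mult_nonneg_nonneg)
  qed
  have "a * ln u + b * ln v + c * ln w + (1 - a - b - c) * ln 1
      \<le> a * (ln m + (u / m - 1)) + b * (ln m + (v / m - 1)) + c * (ln m + (w / m - 1))
        + (1 - a - b - c) * (ln m + (1 / m - 1))"
    using assms \<open>m > 0\<close> by (intro add_mono mult_left_mono ln_le) auto
  also have "\<dots> = ln m - 1 + (a * u + b * v + c * w + (1 - a - b - c)) / m"
    by (simp add: algebra_simps add_divide_distrib diff_divide_distrib)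
  also have "\<dots> = ln m" using \<open>m > 0\<close> by (simp flip: m)
  finally have "exp (a * ln u + b * ln v + c * ln w) \<le> m"
    using \<open>m > 0\<close> by (metis add.right_neutral exp_le_cancel_iff exp_ln ln_one mult_zero_right)
  then show ?thesis
    using assms by (simp add: powr_def exp_add m_def)
qed

text \<open>Dividing by the value at \<open>(X, Y, Z)\<close> reduces the claim to
  \<open>weighted_am_gm3\<close> for the ratios \<open>x / X\<close>, \<open>y / Y\<close>,
  \<open>z / Z\<close>.\<close>

lemma monomial_le_tangent:
  fixes a b c x y z X Y Z :: real
  assumes "a > 0" "b \<ge> 0" "c \<ge> 0" "a + b + c \<le> 1"
    and "x \<ge> 0" "y > 0" "z > 0" and "X > 0" "Y > 0" "Z > 0"
  shows "x powr a * y powr b * z powr c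
    \<le> X powr a * Y powr b * Z powr c * (1 + a * (x / X - 1) + b * (y / Y - 1) + c * (z / Z - 1))"
proof (cases "x = 0")
  case True
  \<comment> \<open>The logarithmic argument excludes a zero ratio. Here the monomial is 0, and the
    tangent factor is at least \<open>1 - a - b - c\<close>, which is nonnegative.\<close>
  have "b * (y / Y) \<ge> 0" "c * (z / Z) \<ge> 0" using assms by auto
  then have "1 - a + b * (y / Y - 1) + c * (z / Z - 1) \<ge> 0"
    using assms unfolding right_diff_distrib by linarith
  with True show ?thesis by simp
next
  case False
  then have "x powr a * y powr b * z powr c
    = X powr a * Y powr b * Z powr c * ((x / X) powr a * (y / Y) powr b * (z / Z) powr c)"
    using assms by (simp add: powr_divide)
  also have "\<dots> \<le> X powr a * Y powr b * Z powr c * (1 + a * (x / X - 1) + b * (y / Y - 1) + c * (z / Z - 1))"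
    using assms False by (intro mult_left_mono weighted_am_gm3) auto
  finally show ?thesis .
qed

text \<open>Take the tangent plane at the convex combination of the two points: it bounds the
  monomial at both points, and being affine it averages to the value at the point of
  tangency.\<close>

lemma monomial_concave:
  fixes a b c s t x y z x' y' z' :: real
  assumes exponents: "a > 0" "b \<ge> 0" "c \<ge> 0" "a + b + c \<le> 1"
    and weights: "s \<ge> 0" "t \<ge> 0" "s + t = 1"
    and points: "x \<ge> 0" "y > 0" "z > 0" "x' \<ge> 0" "y' > 0" "z' > 0"
  shows "s * (x powr a * y powr b * z powr c) + t * (x' powr a * y' powr b * z' powr c)
    \<le> (s * x + t * x') powr a * (s * y + t * y') powr b * (s * z + t * z') powr c"
proof -
  define X Y Z where XYZ: "X = s * x + t * x'" "Y = s * y + t * y'" "Z = s * z + t * z'"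
  show ?thesis
  proof (cases "X = 0")
    case True
    \<comment> \<open>No tangent plane is available at \<open>X = 0\<close>, but then each summand
      has zero weight or a zero first coordinate, so the left side is 0.\<close>
    then have "s * x = 0" "t * x' = 0"
      using weights points unfolding XYZ by (auto simp: add_nonneg_eq_0_iff)
    then show ?thesis using weights by auto
  next
    case False
    have pos: "X > 0" "Y > 0" "Z > 0"
    proof -
      show "X > 0" using False weights points unfolding XYZ
        by (smt (verit) mult_nonneg_nonneg)
      have *: "s > 0 \<or> t > 0" using weights by linarith
      show "Y > 0" "Z > 0" using * weights points unfolding XYZ
        by (auto intro: add_pos_nonneg add_nonneg_pos)
    qed
    let ?F = "X powr a * Y powr b * Z powr c"
    let ?L = "\<lambda>x y z. 1 + a * (x / X - 1) + b * (y / Y - 1) + c * (z / Z - 1)"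
    have "s * (x powr a * y powr b * z powr c) + t * (x' powr a * y' powr b * z' powr c)
      \<le> s * (?F * ?L x y z) + t * (?F * ?L x' y' z')"
      using assms pos by (intro add_mono mult_left_mono monomial_le_tangent) auto
    also have "\<dots> = ?F * ((s + t) * (1 - a - b - c) + a * ((s * x + t * x') / X)
        + b * ((s * y + t * y') / Y) + c * ((s * z + t * z') / Z))"
      by (simp add: algebra_simps add_divide_distrib)
    also have "\<dots> = ?F" using pos weights by (simp flip: XYZ)
    finally show ?thesis unfolding XYZ .
  qed
qed

text \<open>The assumption is midpoint concavity of x^a y^b between (0, e) and (1, 1), where the
  values are 0 and 1. The domains in question exclude y = 0, so that endpoint is reached as a limit,
  giving 1/2 \<le> (1/2)^(a + b).\<close>

lemma exponent_sum_le_1: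
  fixes a b :: real
  assumes "\<And>e. 0 < e \<Longrightarrow> e \<le> 1 \<Longrightarrow> 1 / 2 \<le> (1 / 2) powr a * ((1 + e) / 2) powr b"
  shows "a + b \<le> 1"
proof -
  have "((\<lambda>e. (1 / 2) powr a * ((1 + e) / 2) powr b)
      \<longlongrightarrow> (1 / 2) powr a * ((1 + 0) / 2) powr b) (at_right (0::real))"
    by (intro tendsto_intros) auto
  moreover have "\<forall>\<^sub>F e in at_right (0::real). 1 / 2 \<le> (1 / 2) powr a * ((1 + e) / 2) powr b"
    using eventually_at_right_real[OF zero_less_one] by eventually_elim (rule assms; simp)
  ultimately have "1 / 2 \<le> (1 / 2) powr a * ((1 + 0) / 2) powr b"
    by (intro tendsto_lowerbound) auto
  then have "(1 / 2 :: real) powr 1 \<le> (1 / 2) powr (a + b)"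
    by (simp add: powr_add)
  then show ?thesis by (smt (verit) powr_less_mono' field_sum_of_halves)
qed

theorem lemma2:
  fixes a \<beta> :: real
  assumes "1 / 2 \<le> \<beta>" and "\<beta> < 1" and "a > 0"
  shows "(\<forall>r::real. r > 0 \<longrightarrow>
            (concave_on ({0..1} \<times> {0<..1})
               (\<lambda>(x::real, p::real). x powr a * (r * p) powr (1 - \<beta>))
             \<longleftrightarrow> a \<le> \<beta>))
       \<and> (concave_on ({0..1} \<times> {0<..1} \<times> {0<..})
             (\<lambda>(x::real, p::real, r::real). x powr a * (r * p) powr (1 - \<beta>))
           \<longleftrightarrow> a \<le> 2 * \<beta> - 1)"
proof (intro conjI allI impI iffI)
  fix r :: real
  assume "r > 0" and conc: "concave_on ({0..1} \<times> {0<..1})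
    (\<lambda>(x::real, p::real). x powr a * (r * p) powr (1 - \<beta>))"
  have "1 / 2 \<le> (1 / 2) powr a * ((1 + e) / 2) powr (1 - \<beta>)" if "0 < e" "e \<le> 1" for e
  proof -
    \<comment> \<open>The fixed rate contributes the same positive factor to both sides and
      cancels.\<close>
    have "r powr (1 - \<beta>) * (1 / 2)
      \<le> r powr (1 - \<beta>) * ((1 / 2) powr a * ((1 + e) / 2) powr (1 - \<beta>))"
      using concave_onD[OF conc, of "1/2" "(0, e)" "(1, 1)"] that \<open>r > 0\<close>
      by (simp add: powr_mult add_divide_distrib algebra_simps)
    then show ?thesis
      using \<open>r > 0\<close> by (simp del: times_divide_eq_right)
  qed
  from exponent_sum_le_1[OF this] show "a \<le> \<beta>" by simp
next
  fix r :: real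
  assume "r > 0" "a \<le> \<beta>"
  show "concave_on ({0..1} \<times> {0<..1}) (\<lambda>(x::real, p::real). x powr a * (r * p) powr (1 - \<beta>))"
    unfolding concave_on_iff
  proof (intro conjI ballI allI impI)
    show "convex ({0..1} \<times> {0<..1::real} :: (real \<times> real) set)"
      by (intro convex_Times) auto
  next
    fix z z' :: "real \<times> real" and s t :: real
    assume z: "z \<in> {0..1} \<times> {0<..1}" "z' \<in> {0..1} \<times> {0<..1}" and st: "0 \<le> s" "0 \<le> t" "s + t = 1"
    obtain x p x' p' where zz: "z = (x, p)" "z' = (x', p')" by (metis surj_pair)
    note * = z[unfolded zz] st
    \<comment> \<open>The product \<open>r * p\<close> is linear in \<open>p\<close> and serves as
      the second variable; the third is the constant 1 with exponent 0.\<close>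
    have "s * (x powr a * (r * p) powr (1 - \<beta>) * 1 powr 0) + t * (x' powr a * (r * p') powr (1 - \<beta>) * 1 powr 0)
      \<le> (s * x + t * x') powr a * (s * (r * p) + t * (r * p')) powr (1 - \<beta>) * (s * 1 + t * 1) powr 0"
      using * assms \<open>r > 0\<close> \<open>a \<le> \<beta>\<close> by (intro monomial_concave) auto
    then show "s * (case z of (x, p) \<Rightarrow> x powr a * (r * p) powr (1 - \<beta>))
        + t * (case z' of (x, p) \<Rightarrow> x powr a * (r * p) powr (1 - \<beta>))
      \<le> (case s *\<^sub>R z + t *\<^sub>R z' of (x, p) \<Rightarrow> x powr a * (r * p) powr (1 - \<beta>))"
      using * unfolding zz by (simp add: algebra_simps)
  qed
next
  assume conc: "concave_on ({0..1} \<times> {0<..1} \<times> {0<..})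
    (\<lambda>(x::real, p::real, r::real). x powr a * (r * p) powr (1 - \<beta>))"
  have "1 / 2 \<le> (1 / 2) powr a * ((1 + e) / 2) powr (2 * (1 - \<beta>))" if "0 < e" "e \<le> 1" for e
  proof -
    \<comment> \<open>Moving \<open>p\<close> and \<open>r\<close> together along the diagonal turns
      \<open>r * p\<close> into a square, which doubles the exponent.\<close>
    have "1 / 2 \<le> (1 / 2) powr a * (((1 + e) / 2) * ((1 + e) / 2)) powr (1 - \<beta>)"
      using concave_onD[OF conc, of "1/2" "(0, e, e)" "(1, 1, 1)"] that
      by (simp add: add_divide_distrib add.commute)
    also have "(((1 + e) / 2) * ((1 + e) / 2)) powr (1 - \<beta>) = ((1 + e) / 2) powr (2 * (1 - \<beta>))"
      using that by (simp only: powr_mult mult_2 powr_add)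
    finally show ?thesis .
  qed
  from exponent_sum_le_1[OF this] show "a \<le> 2 * \<beta> - 1" by simp
next
  assume "a \<le> 2 * \<beta> - 1"
  show "concave_on ({0..1} \<times> {0<..1} \<times> {0<..})
    (\<lambda>(x::real, p::real, r::real). x powr a * (r * p) powr (1 - \<beta>))"
    unfolding concave_on_iff
  proof (intro conjI ballI allI impI)
    show "convex ({0..1} \<times> {0<..1} \<times> {0<..} :: (real \<times> real \<times> real) set)"
      by (intro convex_Times) auto
  next
    fix z z' :: "real \<times> real \<times> real" and s t :: real
    assume z: "z \<in> {0..1} \<times> {0<..1} \<times> {0<..}" "z' \<in> {0..1} \<times> {0<..1} \<times> {0<..}"
      and st: "0 \<le> s" "0 \<le> t" "s + t = 1"
    obtain x p r x' p' r' where zz: "z = (x, p, r)" "z' = (x', p', r')" by (metis surj_pair)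
    note * = z[unfolded zz] st
    \<comment> \<open>With \<open>r\<close> varying, \<open>r * p\<close> is no longer linear, so
      \<open>r\<close> and \<open>p\<close> enter as separate variables, each with exponent
      \<open>1 - \<beta>\<close>.\<close>
    have "s * (x powr a * r powr (1 - \<beta>) * p powr (1 - \<beta>)) + t * (x' powr a * r' powr (1 - \<beta>) * p' powr (1 - \<beta>))
      \<le> (s * x + t * x') powr a * (s * r + t * r') powr (1 - \<beta>) * (s * p + t * p') powr (1 - \<beta>)"
      using * assms \<open>a \<le> 2 * \<beta> - 1\<close> by (intro monomial_concave) auto
    then show "s * (case z of (x, p, r) \<Rightarrow> x powr a * (r * p) powr (1 - \<beta>))
        + t * (case z' of (x, p, r) \<Rightarrow> x powr a * (r * p) powr (1 - \<beta>))
      \<le> (case s *\<^sub>R z + t *\<^sub>R z' of (x, p, r) \<Rightarrow> x powr a * (r * p) powr (1 - \<beta>))"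
      using * unfolding zz by (simp add: powr_mult add_pos_pos mult.assoc)
  qed
qed

end
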